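(* The real Banach space $C[0,1]$ (with the supremum norm) is light, but does not admit any isometry invariant LUR renorming.
   Context: A Banach space $X$ is light if its group $\mathrm{Isom}(X)$ of surjective linear isometries is light, i.e. the Weak Operator Topology (generated by the maps $T\mapsto x^*(Tx)$, $x\in X$, $x^*\in X^*$) and the Strong Operator Topology (pointwise norm convergence on $X$) coincide on $\mathrm{Isom}(X)$. A renorming of $X$ is a norm equivalent to the given one; it is isometry invariant if it is invariant under every element of $\mathrm{Isom}(X)$ (isometries for the original norm). A norm $\|\cdot\|$ on $X$ is LUR if it is LUR at every $x_0\neq 0$, i.e. whenever $\lim\|x_n\|=\|x_0\|$ and $\lim\|x_0+x_n\|=2\|x_0\|$, then $\lim\|x_n-x_0\|=0$. *)

theory Defs
  imports "HOL-Analysis.Analysis"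
begin

section \<open>The Banach space \<open>C[0,1]\<close>\<close>

typedef unit_interval = "{0..1::real}"
  morphisms real_of_unit Unit_Interval
  by auto

instantiation unit_interval :: metric_space
begin

definition dist_unit_interval :: "unit_interval \<Rightarrow> unit_interval \<Rightarrow> real"
  where "dist_unit_interval s t = dist (real_of_unit s) (real_of_unit t)"

definition uniformity_unit_interval :: "(unit_interval \<times> unit_interval) filter"
  where "uniformity_unit_interval = (INF e\<in>{0 <..}. principal {(s, t). dist s t < e})"

definition open_unit_interval :: "unit_interval set \<Rightarrow> bool"
  where "open_unit_interval U = (\<forall>s\<in>U. \<forall>\<^sub>F (s', t) in uniformity. s' = s \<longrightarrow> t \<in> U)"

instance
proof
  show "dist s t = 0 \<longleftrightarrow> s = t" for s t :: unit_interval
    by (simp add: dist_unit_interval_def real_of_unit_inject)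
  show "dist s t \<le> dist s u + dist t u" for s t u :: unit_interval
    unfolding dist_unit_interval_def by (rule dist_triangle2)
qed (simp_all add: uniformity_unit_interval_def open_unit_interval_def)

end

text \<open>
  The library type of bounded continuous functions carries the supremum norm. By compactness the
  boundedness condition is vacuous here, see \<open>bcontfun_unit_interval\<close> below.
\<close>

instance bcontfun :: (metric_space, banach) banach ..

type_synonym C01 = "unit_interval \<Rightarrow>\<^sub>C real"

lemma compact_unit_interval: "compact (UNIV :: unit_interval set)"
proof -
  have "continuous_on {0..1} Unit_Interval"
    by (auto simp: continuous_on_iff dist_unit_interval_def Unit_Interval_inverse)
  moreover have "Unit_Interval ` {0..1} = UNIV"
    using type_definition.Abs_image[OF type_definition_unit_interval] .
  ultimately show ?thesis
    using compact_continuous_image[of "{0..1}" Unit_Interval] by simp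
qed

lemma bcontfun_unit_interval:
  "(bcontfun :: (unit_interval \<Rightarrow> real) set) = {f. continuous_on UNIV f}"
  using compact_unit_interval
  by (auto simp: bcontfun_def intro: compact_imp_bounded compact_continuous_image)


section \<open>Light Banach spaces\<close>

text \<open>Linear isometries are automatically bounded, so nothing is lost by using \<open>\<Rightarrow>\<^sub>L\<close>.\<close>

definition Isom :: "('a::real_normed_vector \<Rightarrow>\<^sub>L 'a) set"
  where "Isom = {T. surj (blinfun_apply T) \<and> (\<forall>x. norm (blinfun_apply T x) = norm x)}"

definition weak_operator_topology ::
    "('a::real_normed_vector \<Rightarrow>\<^sub>L 'b::real_normed_vector) topology"
  where "weak_operator_topology = topology_generated_by
    {{T. blinfun_apply \<phi> (blinfun_apply T x) \<in> U} | (\<phi> :: 'b \<Rightarrow>\<^sub>L real) x U. open U}"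

definition light_operators :: "('a::real_normed_vector \<Rightarrow>\<^sub>L 'a) set \<Rightarrow> bool"
  where "light_operators G \<longleftrightarrow>
    subtopology weak_operator_topology G = subtopology strong_operator_topology G"

definition light_space :: "'a::banach itself \<Rightarrow> bool"
  where "light_space _ \<longleftrightarrow> light_operators (Isom :: ('a \<Rightarrow>\<^sub>L 'a) set)"


section \<open>Renormings\<close>

definition is_norm :: "('a::real_vector \<Rightarrow> real) \<Rightarrow> bool"
  where "is_norm N \<longleftrightarrow>
    (\<forall>x. N x \<ge> 0) \<and> (\<forall>x. N x = 0 \<longleftrightarrow> x = 0) \<and>
    (\<forall>c x. N (c *\<^sub>R x) = \<bar>c\<bar> * N x) \<and> (\<forall>x y. N (x + y) \<le> N x + N y)"

definition renorming :: "('a::real_normed_vector \<Rightarrow> real) \<Rightarrow> bool"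
  where "renorming N \<longleftrightarrow>
    is_norm N \<and> (\<exists>a>0. \<exists>b>0. \<forall>x. a * norm x \<le> N x \<and> N x \<le> b * norm x)"

definition isometry_invariant :: "('a::real_normed_vector \<Rightarrow> real) \<Rightarrow> bool"
  where "isometry_invariant N \<longleftrightarrow> (\<forall>T\<in>Isom. \<forall>x. N (blinfun_apply T x) = N x)"

definition LUR_at :: "('a::real_vector \<Rightarrow> real) \<Rightarrow> 'a \<Rightarrow> bool"
  where "LUR_at N x\<^sub>0 \<longleftrightarrow>
    (\<forall>x :: nat \<Rightarrow> 'a. (\<lambda>n. N (x n)) \<longlonglongrightarrow> N x\<^sub>0 \<longrightarrow> (\<lambda>n. N (x\<^sub>0 + x n)) \<longlonglongrightarrow> 2 * N x\<^sub>0 \<longrightarrow>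
      (\<lambda>n. N (x n - x\<^sub>0)) \<longlonglongrightarrow> 0)"

definition LUR :: "('a::real_vector \<Rightarrow> real) \<Rightarrow> bool"
  where "LUR N \<longleftrightarrow> (\<forall>x\<^sub>0. x\<^sub>0 \<noteq> 0 \<longrightarrow> LUR_at N x\<^sub>0)"

end

theory Submission
  imports Defs
begin

text \<open>
  By Banach--Stone every isometry of \<open>C[0,1]\<close> is \<open>f \<mapsto> h \<cdot> (f \<circ> \<phi>)\<close> with a sign \<open>h\<close> and a
  continuous injection \<open>\<phi>\<close> of the interval. Such a \<open>\<phi>\<close> is monotone, and monotone functions that
  are close to a continuous one on a fine enough finite grid are uniformly close to it. Hence
  weak operator closeness on the two functions \<open>1\<close> and \<open>t\<close> controls the strong operator topology.

  The increasing homeomorphisms of \<open>[0,1]\<close> form a convex set and, as functions, a single orbit of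
  the isometry group. An invariant norm is therefore constant on this convex set, so
  it is not even strictly convex.
\<close>

section \<open>The interval and its continuous functions\<close>

lemma real_of_unit_bounds [simp]: "0 \<le> real_of_unit t" "real_of_unit t \<le> 1"
  using real_of_unit[of t] by auto

lemma continuous_on_real_of_unit [continuous_intros]: "continuous_on S real_of_unit"
  by (auto simp: continuous_on_iff dist_unit_interval_def)

lemma continuous_on_Unit_Interval: "continuous_on {0..1} Unit_Interval"
  by (auto simp: continuous_on_iff dist_unit_interval_def Unit_Interval_inverse)

lemma Unit_Interval_image: "Unit_Interval ` {0..1} = UNIV"
  using type_definition.Abs_image[OF type_definition_unit_interval] .

lemma connected_unit_interval: "connected (UNIV :: unit_interval set)"
  using connected_continuous_image[OF continuous_on_Unit_Interval] by (simp add: Unit_Interval_image)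

lemma apply_Bcontfun_unit_interval:
  fixes g :: "unit_interval \<Rightarrow> real"
  assumes "continuous_on UNIV g"
  shows "apply_bcontfun (Bcontfun g) = g"
  using assms by (simp add: Bcontfun_inverse bcontfun_unit_interval)

definition coordinate :: C01
  where "coordinate = Bcontfun real_of_unit"

lemma apply_coordinate [simp]: "apply_bcontfun coordinate t = real_of_unit t"
  by (simp add: coordinate_def apply_Bcontfun_unit_interval continuous_on_real_of_unit)

definition abs_C01 :: "C01 \<Rightarrow> C01"
  where "abs_C01 f = Bcontfun (\<lambda>t. \<bar>apply_bcontfun f t\<bar>)"

lemma apply_abs_C01 [simp]: "apply_bcontfun (abs_C01 f) t = \<bar>apply_bcontfun f t\<bar>"
  by (simp add: abs_C01_def apply_Bcontfun_unit_interval continuous_on_rabs)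

lemma abs_bcontfun_le_norm: "\<bar>apply_bcontfun f t\<bar> \<le> norm f" for f :: C01
  using norm_bounded[of f t] by simp

lemma norm_C01_le: "(\<And>t. \<bar>apply_bcontfun f t\<bar> \<le> b) \<Longrightarrow> norm f \<le> b" for f :: C01
  by (rule norm_bound) simp

section \<open>Isometries of \<open>C[0,1]\<close>\<close>

lemma Isom_norm: "T \<in> Isom \<Longrightarrow> norm (blinfun_apply T x) = norm x"
  by (simp add: Isom_def)

lemma Isom_surjE:
  assumes "T \<in> Isom"
  obtains x where "blinfun_apply T x = y"
proof -
  have "surj (blinfun_apply T)" using assms by (simp add: Isom_def)
  then show thesis using that by (metis surjD)
qed

lemma Isom_uminus: "T \<in> Isom \<Longrightarrow> - T \<in> Isom"
  unfolding Isom_def surj_def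
  by (auto simp: blinfun.minus_left) (metis blinfun.minus_right minus_equation_iff)

text \<open>The function \<open>1 - \<bar>T 1\<bar>\<close> is the image of some \<open>v\<close> with \<open>\<parallel>1 \<plusminus> v\<parallel> \<le> 1\<close>, which forces \<open>v = 0\<close>.\<close>

lemma Isom_one_abs:
  fixes T :: "C01 \<Rightarrow>\<^sub>L C01"
  assumes "T \<in> Isom"
  shows "\<bar>apply_bcontfun (blinfun_apply T (const_bcontfun 1)) t\<bar> = 1"
proof -
  define e :: C01 where "e = const_bcontfun 1"
  define u where "u = e - abs_C01 (blinfun_apply T e)"
  obtain v where v: "blinfun_apply T v = u" using Isom_surjE[OF assms] .
  have "norm e \<le> 1" by (rule norm_C01_le) (simp add: e_def)
  then have le1: "\<bar>apply_bcontfun (blinfun_apply T e) s\<bar> \<le> 1" for s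
    using abs_bcontfun_le_norm[of "blinfun_apply T e" s] Isom_norm[OF assms, of e] by simp
  \<comment> \<open>The number \<open>1 - \<bar>a\<bar>\<close> is the distance from
    \<open>a\<close> to the boundary of the interval from -1 to 1, so a move by it in either
    direction stays inside.\<close>
  have aux: "\<bar>a + (1 - \<bar>a\<bar>)\<bar> \<le> 1 \<and> \<bar>a - (1 - \<bar>a\<bar>)\<bar> \<le> 1" if "\<bar>a\<bar> \<le> 1" for a :: real
    using that by arith
  have "norm (blinfun_apply T e + u) \<le> 1" "norm (blinfun_apply T e - u) \<le> 1"
    using aux[OF le1] by (auto intro!: norm_C01_le simp: u_def e_def)
  then have "norm (e + v) \<le> 1" "norm (e - v) \<le> 1"
    using Isom_norm[OF assms, of "e + v"] Isom_norm[OF assms, of "e - v"]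
    by (auto simp: v blinfun.add_right blinfun.diff_right)
  then have "apply_bcontfun v s = 0" for s
    using abs_bcontfun_le_norm[of "e + v" s] abs_bcontfun_le_norm[of "e - v" s] by (simp add: e_def)
  then have "v = 0" by (intro bcontfun_eqI) simp
  then have "u = 0" using v by (simp add: blinfun.zero_right)
  then have "apply_bcontfun u t = 0" by simp
  then show ?thesis by (simp add: u_def e_def)
qed

text \<open>The image of the constant 1 takes only the values 1 and -1, and the interval is
  connected, so one sign serves for all points.\<close>

lemma Isom_one_const:
  fixes T :: "C01 \<Rightarrow>\<^sub>L C01"
  assumes "T \<in> Isom"
  obtains h :: real where "\<bar>h\<bar> = 1" "blinfun_apply T (const_bcontfun 1) = const_bcontfun h"
proof -
  let ?g = "apply_bcontfun (blinfun_apply T (const_bcontfun 1))"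
  have "connected (range ?g)"
    by (intro connected_continuous_image connected_unit_interval continuous_on_apply_bcontfun)
  moreover have sub: "range ?g \<subseteq> {1, -1}"
    using Isom_one_abs[OF assms] by (auto simp: abs_if split: if_splits) (metis minus_equation_iff)
  ultimately obtain h where h: "range ?g = {h}"
    using connected_finite_iff_sing[of "range ?g"] finite_subset[OF sub] by auto
  then have gh: "?g t = h" for t by (metis rangeI singletonD)
  show thesis
  proof
    show "\<bar>h\<bar> = 1" using Isom_one_abs[OF assms] gh by metis
    show "blinfun_apply T (const_bcontfun 1) = const_bcontfun h"
      using gh by (intro bcontfun_eqI) simp
  qed
qed

section \<open>Unital isometries: preservation of order and the induced point map\<close>

locale unital_isometry =
  fixes T :: "C01 \<Rightarrow>\<^sub>L C01"
  assumes Isom: "T \<in> Isom" and one: "blinfun_apply T (const_bcontfun 1) = const_bcontfun 1"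
begin

lemma const: "blinfun_apply T (const_bcontfun c) = const_bcontfun c"
proof -
  have "const_bcontfun c = c *\<^sub>R (const_bcontfun 1 :: C01)" by (rule bcontfun_eqI) simp
  then show ?thesis by (simp add: blinfun.scaleR_right one)
qed

text \<open>Positivity is expressed by the norm: \<open>f \<ge> 0\<close> iff \<open>\<parallel>c - f\<parallel> \<le> c\<close> for \<open>c = \<parallel>f\<parallel>\<close>.\<close>

lemma nonneg_iff: "(\<forall>t. 0 \<le> apply_bcontfun f t) \<longleftrightarrow> norm (const_bcontfun (norm f) - f) \<le> norm f"
  for f :: C01
proof
  assume "\<forall>t. 0 \<le> apply_bcontfun f t"
  then show "norm (const_bcontfun (norm f) - f) \<le> norm f"
    using abs_bcontfun_le_norm[of f] by (auto intro!: norm_C01_le simp: abs_le_iff)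
next
  assume *: "norm (const_bcontfun (norm f) - f) \<le> norm f"
  show "\<forall>t. 0 \<le> apply_bcontfun f t"
  proof
    fix t
    show "0 \<le> apply_bcontfun f t"
      using abs_bcontfun_le_norm[of "const_bcontfun (norm f) - f" t] * by simp
  qed
qed

text \<open>The criterion \<open>nonneg_iff\<close> mentions only norms and constants.
  \<open>T\<close> preserves both, so it holds for \<open>f\<close> exactly when it holds for the
  image of \<open>f\<close>.\<close>

lemma nonneg_image_iff:
  "(\<forall>t. 0 \<le> apply_bcontfun (blinfun_apply T f) t) \<longleftrightarrow> (\<forall>t. 0 \<le> apply_bcontfun f t)"
proof -
  have "blinfun_apply T (const_bcontfun (norm f) - f) = const_bcontfun (norm f) - blinfun_apply T f"
    by (simp add: blinfun.diff_right const)
  then show ?thesis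
    unfolding nonneg_iff by (metis Isom Isom_norm)
qed

lemma le_image_iff:
  "(\<forall>t. apply_bcontfun (blinfun_apply T f) t \<le> apply_bcontfun (blinfun_apply T g) t)
    \<longleftrightarrow> (\<forall>t. apply_bcontfun f t \<le> apply_bcontfun g t)"
  using nonneg_image_iff[of "g - f"] by (simp add: blinfun.diff_right)

lemma image_mono:
  "(\<And>t. apply_bcontfun f t \<le> apply_bcontfun g t) \<Longrightarrow>
    apply_bcontfun (blinfun_apply T f) t \<le> apply_bcontfun (blinfun_apply T g) t"
  using le_image_iff by blast

text \<open>By surjectivity the modulus of the image of \<open>f\<close> is itself the image of some
  \<open>u\<close>. As \<open>T\<close> reflects order, \<open>u\<close> dominates \<open>f\<close>
  and \<open>- f\<close>, hence \<open>abs_C01 f\<close>; applying \<open>T\<close> again gives the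
  bound.\<close>

lemma abs_image_le: "apply_bcontfun (blinfun_apply T (abs_C01 f)) t \<le> \<bar>apply_bcontfun (blinfun_apply T f) t\<bar>"
proof -
  obtain u where u: "blinfun_apply T u = abs_C01 (blinfun_apply T f)" using Isom_surjE[OF Isom] .
  have "apply_bcontfun f s \<le> apply_bcontfun u s" for s
    using le_image_iff[of f u] by (simp add: u abs_ge_self)
  moreover have "apply_bcontfun (- f) s \<le> apply_bcontfun u s" for s
    using le_image_iff[of "- f" u] by (simp add: u blinfun.minus_right abs_ge_minus_self)
  ultimately have "apply_bcontfun (abs_C01 f) s \<le> apply_bcontfun u s" for s
    by (simp add: abs_le_iff)
  then show ?thesis using image_mono[of "abs_C01 f" u t] by (simp add: u)
qed

text \<open>If \<open>T\<close> is composition with a point map, then its value on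
  \<open>coordinate\<close> must be that map read as a real function. This recovers the only
  candidate.\<close>

definition symbol :: "unit_interval \<Rightarrow> unit_interval"
  where "symbol t = Unit_Interval (apply_bcontfun (blinfun_apply T coordinate) t)"

lemma real_of_symbol: "real_of_unit (symbol t) = apply_bcontfun (blinfun_apply T coordinate) t"
proof -
  have "0 \<le> apply_bcontfun (blinfun_apply T coordinate) t"
    using image_mono[of "const_bcontfun 0" coordinate t] by (simp add: const blinfun.zero_right)
  moreover have "apply_bcontfun (blinfun_apply T coordinate) t \<le> 1"
    using image_mono[of coordinate "const_bcontfun 1" t] by (simp add: const)
  ultimately show ?thesis unfolding symbol_def by (simp add: Unit_Interval_inverse)
qed

lemma continuous_on_symbol: "continuous_on UNIV symbol"
proof -
  have "continuous_on UNIV (\<lambda>t. real_of_unit (symbol t))"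
    unfolding real_of_symbol by simp
  then show ?thesis by (simp add: continuous_on_iff dist_unit_interval_def)
qed

text \<open>
  Near \<open>symbol t\<close> the function \<open>f\<close> is almost constant, and away from it \<open>f\<close> is dominated by a
  multiple of \<open>\<bar>coordinate - symbol t\<bar>\<close>, whose image vanishes at \<open>t\<close>.
\<close>

lemma apply_eq_symbol: "apply_bcontfun (blinfun_apply T f) t = apply_bcontfun f (symbol t)"
proof -
  define s where "s = symbol t"
  define p where "p = abs_C01 (coordinate - const_bcontfun (real_of_unit s))"
  have "apply_bcontfun (blinfun_apply T p) t \<le> 0"
    using abs_image_le[of "coordinate - const_bcontfun (real_of_unit s)" t]
    by (simp add: p_def blinfun.diff_right const s_def real_of_symbol)
  then have p0: "apply_bcontfun (blinfun_apply T p) t = 0"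
    using image_mono[of 0 p t] by (simp add: p_def blinfun.zero_right)
  define k where "k = f - const_bcontfun (apply_bcontfun f s)"
  have Tk: "apply_bcontfun (blinfun_apply T k) t = apply_bcontfun (blinfun_apply T f) t - apply_bcontfun f s"
    by (simp add: k_def blinfun.diff_right const)
  have "\<bar>apply_bcontfun (blinfun_apply T k) t\<bar> \<le> e" if "e > 0" for e
  proof -
    have "continuous_on UNIV (apply_bcontfun f)" by simp
    then obtain d where d: "d > 0"
      "\<And>r. dist r s < d \<Longrightarrow> dist (apply_bcontfun f r) (apply_bcontfun f s) < e"
      using \<open>e > 0\<close> unfolding continuous_on_iff by (metis UNIV_I)
    \<comment> \<open>Chosen so that \<open>C * d\<close> equals \<open>2 * norm f\<close>, which
      bounds the difference of any two values of \<open>f\<close>.\<close>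
    define C where "C = 2 * norm f / d"
    have C: "C \<ge> 0" using d by (simp add: C_def)
    have bound: "\<bar>apply_bcontfun k r\<bar> \<le> e + C * apply_bcontfun p r" for r
    proof (cases "dist r s < d")
      case True
      then show ?thesis
        using d(2)[of r] C by (auto simp: k_def p_def dist_real_def intro: add_increasing2)
    next
      case False
      then have "d \<le> apply_bcontfun p r"
        by (simp add: p_def dist_unit_interval_def dist_real_def)
      then have "C * d \<le> C * apply_bcontfun p r" using C by (rule mult_left_mono)
      moreover have "\<bar>apply_bcontfun k r\<bar> \<le> C * d"
        using abs_bcontfun_le_norm[of f r] abs_bcontfun_le_norm[of f s] d by (simp add: C_def k_def)
      ultimately show ?thesis using \<open>e > 0\<close> by simp
    qed
    have Tb: "apply_bcontfun (blinfun_apply T (const_bcontfun e + C *\<^sub>R p)) t = e"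
      by (simp add: blinfun.add_right blinfun.scaleR_right const p0)
    have "apply_bcontfun (blinfun_apply T k) t \<le> e"
      using image_mono[of k "const_bcontfun e + C *\<^sub>R p" t] bound Tb by (simp add: abs_le_iff)
    moreover have "apply_bcontfun (blinfun_apply T (- k)) t \<le> e"
      using image_mono[of "- k" "const_bcontfun e + C *\<^sub>R p" t] bound Tb by (simp add: abs_le_iff)
    ultimately show ?thesis by (simp add: abs_le_iff blinfun.minus_right)
  qed
  then have "\<bar>apply_bcontfun (blinfun_apply T k) t\<bar> \<le> 0"
    by (rule field_le_epsilon) simp
  then show ?thesis by (simp add: Tk s_def)
qed

text \<open>Some function has \<open>coordinate\<close> as its image, so \<open>coordinate\<close>
  factors through \<open>symbol\<close>; and \<open>coordinate\<close> separates points.\<close>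

lemma inj_symbol: "inj symbol"
proof (rule injI)
  fix s t assume eq: "symbol s = symbol t"
  obtain f where "blinfun_apply T f = coordinate" using Isom_surjE[OF Isom] .
  then have "real_of_unit s = real_of_unit t"
    using apply_eq_symbol[of f s] apply_eq_symbol[of f t] eq by simp
  then show "s = t" by (simp add: real_of_unit_inject)
qed

end

text \<open>Multiplication of \<open>T\<close> by its own sign \<open>h\<close> yields a unital
  isometry because \<open>h * h = 1\<close>. The point map of that isometry serves as
  \<open>\<phi>\<close>.\<close>

lemma Banach_Stone_C01:
  fixes T :: "C01 \<Rightarrow>\<^sub>L C01"
  assumes "T \<in> Isom"
  obtains h :: real and \<phi> :: "unit_interval \<Rightarrow> unit_interval"
  where "\<bar>h\<bar> = 1" "continuous_on UNIV \<phi>" "inj \<phi>"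
    "\<And>f t. apply_bcontfun (blinfun_apply T f) t = h * apply_bcontfun f (\<phi> t)"
proof -
  obtain h where h: "\<bar>h\<bar> = 1" "blinfun_apply T (const_bcontfun 1) = const_bcontfun h"
    using Isom_one_const[OF assms] .
  have "h = 1 \<or> h = -1" using h(1) by linarith
  then have "h *\<^sub>R T \<in> Isom" using assms Isom_uminus by auto
  moreover have "h *\<^sub>R const_bcontfun h = (const_bcontfun 1 :: C01)"
    using \<open>h = 1 \<or> h = -1\<close> by (intro bcontfun_eqI) auto
  ultimately interpret unital_isometry "h *\<^sub>R T"
    by unfold_locales (simp_all add: blinfun.scaleR_left h(2))
  show thesis
  proof
    show "apply_bcontfun (blinfun_apply T f) t = h * apply_bcontfun f (symbol t)" for f t
      using apply_eq_symbol[of f t] \<open>h = 1 \<or> h = -1\<close> by (auto simp: blinfun.scaleR_left)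
  qed (use h continuous_on_symbol inj_symbol in auto)
qed

text \<open>Surjectivity of \<open>\<phi>\<close> makes composition preserve the supremum. The
  operator is onto because a continuous bijection of a compact Hausdorff space has a continuous
  inverse, and composition with that inverse supplies preimages.\<close>

lemma composition_Isom:
  fixes \<phi> :: "unit_interval \<Rightarrow> unit_interval"
  assumes cont: "continuous_on UNIV \<phi>" and bij: "bij \<phi>"
  obtains T :: "C01 \<Rightarrow>\<^sub>L C01" where "T \<in> Isom"
    "\<And>f t. apply_bcontfun (blinfun_apply T f) t = apply_bcontfun f (\<phi> t)"
proof -
  define L :: "C01 \<Rightarrow> C01" where "L f = Bcontfun (\<lambda>t. apply_bcontfun f (\<phi> t))" for f
  have comp: "continuous_on UNIV (\<lambda>t. apply_bcontfun f (\<theta> t))"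
    if "continuous_on UNIV \<theta>" for f :: C01 and \<theta> :: "unit_interval \<Rightarrow> unit_interval"
    using continuous_on_compose[OF that continuous_on_apply_bcontfun] by (simp add: comp_def)
  have L: "apply_bcontfun (L f) t = apply_bcontfun f (\<phi> t)" for f t
    by (simp add: L_def apply_Bcontfun_unit_interval comp cont)
  have norm_le: "norm (L f) \<le> norm f" for f
    by (rule norm_C01_le) (simp add: L abs_bcontfun_le_norm)
  have "bounded_linear L"
    using norm_le by (intro bounded_linear_intro[where K=1] bcontfun_eqI) (simp_all add: L)
  then have app: "blinfun_apply (Blinfun L) = L" by (rule bounded_linear_Blinfun_apply)
  have surj\<phi>: "\<exists>r. \<phi> r = t" for t using bij by (metis bij_pointE)
  have "norm f \<le> norm (L f)" for f
  proof (rule norm_C01_le)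
    fix t obtain r where "\<phi> r = t" using surj\<phi> by blast
    then show "\<bar>apply_bcontfun f t\<bar> \<le> norm (L f)"
      using abs_bcontfun_le_norm[of "L f" r] by (simp add: L)
  qed
  moreover have "surj L"
  proof -
    have inv: "inv \<phi> (\<phi> t) = t" for t using bij by (simp add: bij_is_inj)
    then have "continuous_on (range \<phi>) (inv \<phi>)"
      by (intro continuous_on_inv[OF cont compact_unit_interval]) auto
    then have c: "continuous_on UNIV (inv \<phi>)" using bij by (simp add: bij_is_surj)
    have "L (Bcontfun (\<lambda>t. apply_bcontfun f (inv \<phi> t))) = f" for f
      by (rule bcontfun_eqI) (simp add: L apply_Bcontfun_unit_interval comp c inv)
    then show ?thesis by (rule surjI)
  qed
  ultimately have "Blinfun L \<in> Isom"
    using norm_le by (auto simp: Isom_def app intro: antisym)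
  then show thesis using that L app by metis
qed

section \<open>Lightness\<close>

text \<open>A continuous injection of an interval is strictly monotone. The unoriented
  \<open>closed_segment\<close> covers the increasing and the decreasing case at once.\<close>

lemma continuous_inj_unit_interval_between:
  fixes \<phi> :: "unit_interval \<Rightarrow> unit_interval"
  assumes cont: "continuous_on UNIV \<phi>" and inj: "inj \<phi>"
    and le: "real_of_unit p \<le> real_of_unit t" "real_of_unit t \<le> real_of_unit q"
  shows "real_of_unit (\<phi> t) \<in> closed_segment (real_of_unit (\<phi> p)) (real_of_unit (\<phi> q))"
proof (cases "t = p \<or> t = q")
  case False
  define g where "g x = real_of_unit (\<phi> (Unit_Interval x))" for x
  have g: "g (real_of_unit r) = real_of_unit (\<phi> r)" for r
    by (simp add: g_def real_of_unit_inverse)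
  have sub: "{real_of_unit p..real_of_unit q} \<subseteq> {0..1}"
    using real_of_unit_bounds order_trans by auto
  have "continuous_on {0..1} g"
    unfolding g_def
    by (rule continuous_on_compose2[OF continuous_on_real_of_unit[of UNIV]
          continuous_on_compose2[OF cont continuous_on_Unit_Interval]]) auto
  moreover have "inj_on g {0..1}"
    by (rule inj_onI) (auto simp: g_def real_of_unit_inject Unit_Interval_inject dest!: injD[OF inj])
  moreover have "real_of_unit p < real_of_unit t" "real_of_unit t < real_of_unit q"
    using False le real_of_unit_inject by (metis order_le_less)+
  ultimately have "(g (real_of_unit p) < g (real_of_unit t) \<and> g (real_of_unit t) < g (real_of_unit q)) \<or>
    (g (real_of_unit q) < g (real_of_unit t) \<and> g (real_of_unit t) < g (real_of_unit p))"
    using sub by (intro continuous_inj_imp_mono) (blast intro: continuous_on_subset inj_on_subset)+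
  then show ?thesis by (auto simp: g closed_segment_eq_real_ivl)
qed auto

lemma unit_interval_grid:
  assumes "\<eta> > 0"
  obtains F :: "unit_interval set" where "finite F"
    "\<And>t. \<exists>p\<in>F. \<exists>q\<in>F. real_of_unit p \<le> real_of_unit t \<and> real_of_unit t \<le> real_of_unit q \<and>
      dist p t < \<eta> \<and> dist q t < \<eta>"
proof -
  obtain n where n: "n > 0" "inverse (real n) < \<eta>"
    using ex_inverse_of_nat_less[OF assms] by blast
  \<comment> \<open>The cap at 1 matters for the right neighbour of \<open>t = 1\<close>: there the
    index is \<open>Suc n\<close>, and the quotient would leave the interval.\<close>
  define P where "P i = Unit_Interval (min 1 (real i / real n))" for i :: nat
  have P: "real_of_unit (P i) = min 1 (real i / real n)" for i
    unfolding P_def by (rule Unit_Interval_inverse) auto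
  show thesis
  proof
    show "finite (P ` {..Suc n})" by simp
    fix t
    define x where "x = real_of_unit t"
    have x: "0 \<le> x" "x \<le> 1" by (auto simp: x_def)
    define i where "i = nat \<lfloor>real n * x\<rfloor>"
    have i: "real i \<le> real n * x" "real n * x < real i + 1"
      using x by (auto simp: i_def)
    have "real n * x \<le> real n" using x by (simp add: mult_left_le)
    then have "i \<le> n" using i(1) by linarith
    have lo: "real i / real n \<le> x" and hi: "x < (real i + 1) / real n"
      using i n(1) by (simp_all add: field_simps)
    have gap: "(real i + 1) / real n - real i / real n < \<eta>"
      using n by (simp add: diff_divide_distrib[symmetric] inverse_eq_divide)
    have "real_of_unit (P i) \<le> x" "x \<le> real_of_unit (P (Suc i))"
      "dist (P i) t < \<eta>" "dist (P (Suc i)) t < \<eta>"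
      using lo hi gap x
      by (auto simp: P dist_unit_interval_def dist_real_def x_def[symmetric] min_def add.commute)
    then show "\<exists>p\<in>P ` {..Suc n}. \<exists>q\<in>P ` {..Suc n}. real_of_unit p \<le> real_of_unit t \<and>
        real_of_unit t \<le> real_of_unit q \<and> dist p t < \<eta> \<and> dist q t < \<eta>"
      using \<open>i \<le> n\<close> unfolding x_def
      by (intro bexI[of _ "P i"] bexI[of _ "P (Suc i)"]) auto
  qed
qed

text \<open>The grid \<open>F\<close> is fine enough that \<open>\<phi>\<close> varies by less than
  \<open>\<delta>\<close> between \<open>t\<close> and its grid neighbours, so \<open>\<psi>\<close>
  sends both neighbours into the ball of radius \<open>2 * \<delta>\<close> around
  \<open>\<phi> t\<close>. By monotonicity \<open>\<psi> t\<close> lies between these two values,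
  and the ball is convex. The choice of \<open>F\<close> precedes that of
  \<open>\<psi>\<close>.\<close>

lemma uniformly_close_from_finite:
  fixes \<phi> :: "unit_interval \<Rightarrow> unit_interval"
  assumes "continuous_on UNIV \<phi>" and "\<delta> > 0"
  obtains F where "finite F"
    "\<And>\<psi> t. continuous_on UNIV \<psi> \<Longrightarrow> inj \<psi> \<Longrightarrow> (\<And>p. p \<in> F \<Longrightarrow> dist (\<psi> p) (\<phi> p) < \<delta>) \<Longrightarrow>
      dist (\<psi> t) (\<phi> t) < 2 * \<delta>"
proof -
  have "uniformly_continuous_on UNIV \<phi>"
    using assms(1) compact_unit_interval by (rule compact_uniformly_continuous)
  then obtain \<eta> where \<eta>: "\<eta> > 0" "\<And>s t. dist s t < \<eta> \<Longrightarrow> dist (\<phi> s) (\<phi> t) < \<delta>"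
    using \<open>\<delta> > 0\<close> unfolding uniformly_continuous_on_def by (metis UNIV_I)
  obtain F where F: "finite F"
    "\<And>t. \<exists>p\<in>F. \<exists>q\<in>F. real_of_unit p \<le> real_of_unit t \<and> real_of_unit t \<le> real_of_unit q \<and>
      dist p t < \<eta> \<and> dist q t < \<eta>"
    using unit_interval_grid[OF \<eta>(1)] by blast
  show thesis
  proof (rule that[OF F(1)])
    fix \<psi> :: "unit_interval \<Rightarrow> unit_interval" and t
    assume \<psi>: "continuous_on UNIV \<psi>" "inj \<psi>" and close: "\<And>p. p \<in> F \<Longrightarrow> dist (\<psi> p) (\<phi> p) < \<delta>"
    obtain p q where pq: "p \<in> F" "q \<in> F" "real_of_unit p \<le> real_of_unit t"
      "real_of_unit t \<le> real_of_unit q" "dist p t < \<eta>" "dist q t < \<eta>"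
      using F(2)[of t] by blast
    have "dist (\<psi> r) (\<phi> t) < 2 * \<delta>" if "r \<in> F" "dist r t < \<eta>" for r
      using dist_triangle[of "\<psi> r" "\<phi> t" "\<phi> r"] close[OF that(1)] \<eta>(2)[OF that(2)] by linarith
    then have "real_of_unit (\<psi> p) \<in> ball (real_of_unit (\<phi> t)) (2 * \<delta>)"
      "real_of_unit (\<psi> q) \<in> ball (real_of_unit (\<phi> t)) (2 * \<delta>)"
      using pq by (auto simp: dist_unit_interval_def dist_commute)
    then have "closed_segment (real_of_unit (\<psi> p)) (real_of_unit (\<psi> q)) \<subseteq> ball (real_of_unit (\<phi> t)) (2 * \<delta>)"
      by (intro closed_segment_subset convex_ball)
    then show "dist (\<psi> t) (\<phi> t) < 2 * \<delta>"
      using continuous_inj_unit_interval_between[OF \<psi> pq(3,4)]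
      by (auto simp: dist_unit_interval_def dist_commute)
  qed
qed

text \<open>The values on the constant 1 determine the sign of \<open>S\<close>, and those on
  \<open>coordinate\<close> control its point map on the grid, hence uniformly. Uniform continuity
  of \<open>f\<close> then transfers this to the images of \<open>f\<close>.\<close>

lemma Isom_close_from_finite:
  fixes T :: "C01 \<Rightarrow>\<^sub>L C01" and f :: C01
  assumes "T \<in> Isom" and "e > 0"
  obtains F \<delta> where "finite F" "\<delta> > 0"
    "\<And>S. S \<in> Isom \<Longrightarrow>
      (\<And>g p. g \<in> {const_bcontfun 1, coordinate} \<Longrightarrow> p \<in> F \<Longrightarrow>
        dist (apply_bcontfun (blinfun_apply S g) p) (apply_bcontfun (blinfun_apply T g) p) < \<delta>) \<Longrightarrow>
      dist (blinfun_apply S f) (blinfun_apply T f) < e"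
proof -
  obtain h \<phi> where T: "\<bar>h\<bar> = 1" "continuous_on UNIV \<phi>" "inj \<phi>"
    "\<And>f t. apply_bcontfun (blinfun_apply T f) t = h * apply_bcontfun f (\<phi> t)"
    using Banach_Stone_C01[OF assms(1)] by blast
  have "uniformly_continuous_on UNIV (apply_bcontfun f)"
    using compact_unit_interval by (intro compact_uniformly_continuous) auto
  then obtain \<eta> where \<eta>: "\<eta> > 0"
    "\<And>s t. dist s t < \<eta> \<Longrightarrow> dist (apply_bcontfun f s) (apply_bcontfun f t) < e / 2"
    using half_gt_zero[OF \<open>e > 0\<close>] unfolding uniformly_continuous_on_def by (metis UNIV_I)
  \<comment> \<open>The bound 1 separates the two possible signs, which are 2 apart; the bound
    \<open>\<eta> / 2\<close> turns the later distance \<open>2 * \<delta>\<close> into at most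
    \<open>\<eta>\<close>.\<close>
  define \<delta> where "\<delta> = min 1 (\<eta> / 2)"
  have "\<delta> > 0" using \<eta>(1) by (simp add: \<delta>_def)
  then obtain F where F: "finite F"
    "\<And>\<psi> t. continuous_on UNIV \<psi> \<Longrightarrow> inj \<psi> \<Longrightarrow> (\<And>p. p \<in> F \<Longrightarrow> dist (\<psi> p) (\<phi> p) < \<delta>) \<Longrightarrow>
      dist (\<psi> t) (\<phi> t) < 2 * \<delta>"
    using uniformly_close_from_finite[OF T(2)] by blast
  show thesis
  \<comment> \<open>The added point guarantees a place where the signs can be compared, whatever
    \<open>F\<close> is.\<close>
  proof (rule that[of "insert (Unit_Interval 0) F" \<delta>])
    fix S :: "C01 \<Rightarrow>\<^sub>L C01"
    assume "S \<in> Isom" and close: "\<And>g p. g \<in> {const_bcontfun 1, coordinate} \<Longrightarrow>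
      p \<in> insert (Unit_Interval 0) F \<Longrightarrow>
      dist (apply_bcontfun (blinfun_apply S g) p) (apply_bcontfun (blinfun_apply T g) p) < \<delta>"
    obtain k \<psi> where S: "\<bar>k\<bar> = 1" "continuous_on UNIV \<psi>" "inj \<psi>"
      "\<And>f t. apply_bcontfun (blinfun_apply S f) t = k * apply_bcontfun f (\<psi> t)"
      using Banach_Stone_C01[OF \<open>S \<in> Isom\<close>] by blast
    have "\<bar>k - h\<bar> < 1"
      using close[of "const_bcontfun 1" "Unit_Interval 0"] by (simp add: S T dist_real_def \<delta>_def)
    then have "k = h" using S(1) T(1) by linarith
    have h: "\<bar>h * x - h * y\<bar> = \<bar>x - y\<bar>" for x y
      using T(1) by (simp add: abs_mult right_diff_distrib[symmetric])
    have "dist (\<psi> p) (\<phi> p) < \<delta>" if "p \<in> F" for p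
      using close[of coordinate p] that
      by (simp add: S T \<open>k = h\<close> h dist_unit_interval_def dist_real_def)
    then have "dist (\<psi> t) (\<phi> t) < \<eta>" for t
      using F(2)[OF S(2,3), of t] by (force simp: \<delta>_def)
    then have "dist (apply_bcontfun (blinfun_apply S f) t) (apply_bcontfun (blinfun_apply T f) t) \<le> e / 2" for t
      using \<eta>(2)[of "\<psi> t" "\<phi> t"] by (simp add: S T \<open>k = h\<close> h dist_real_def less_imp_le)
    \<comment> \<open>Passing to the supremum keeps only a weak inequality; the margin
      \<open>e / 2\<close> restores the strict one.\<close>
    then have "dist (blinfun_apply S f) (blinfun_apply T f) \<le> e / 2" by (rule dist_bound)
    then show "dist (blinfun_apply S f) (blinfun_apply T f) < e" using \<open>e > 0\<close> by simp
  qed (use F \<open>\<delta> > 0\<close> in auto)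
qed

section \<open>Comparison of the weak and strong operator topologies\<close>

lemma openin_weak_operator_topology:
  fixes \<phi> :: "'b::real_normed_vector \<Rightarrow>\<^sub>L real" and x :: "'a::real_normed_vector"
  assumes "open U"
  shows "openin weak_operator_topology {T :: 'a \<Rightarrow>\<^sub>L 'b. blinfun_apply \<phi> (blinfun_apply T x) \<in> U}"
  unfolding weak_operator_topology_def
  by (rule topology_generated_by_Basis) (use assms in blast)

lemma topspace_weak_operator_topology [simp]: "topspace weak_operator_topology = UNIV"
  using openin_subset[OF openin_weak_operator_topology[of UNIV]] by auto

lemma continuous_map_strong_weak_operator_topology:
  "continuous_map strong_operator_topology
    (weak_operator_topology :: ('a::real_normed_vector \<Rightarrow>\<^sub>L 'b::real_normed_vector) topology) id"
  unfolding weak_operator_topology_def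
proof (rule continuous_on_generated_topo)
  fix W :: "('a \<Rightarrow>\<^sub>L 'b) set"
  assume "W \<in> {{T. blinfun_apply \<phi> (blinfun_apply T x) \<in> U} | (\<phi> :: 'b \<Rightarrow>\<^sub>L real) x U. open U}"
  then obtain \<phi> :: "'b \<Rightarrow>\<^sub>L real" and x U where W: "W = {T. blinfun_apply \<phi> (blinfun_apply T x) \<in> U}" "open U"
    by blast
  have "continuous_on UNIV (blinfun_apply \<phi>)" by (intro continuous_intros)
  then have "open (blinfun_apply \<phi> -` U)" using \<open>open U\<close> by (simp add: open_vimage)
  \<comment> \<open>A subbasic weak set constrains a single vector \<open>x\<close>, so the finite
    index set of the strong basis is the one-point set.\<close>
  then have "openin strong_operator_topology {T. \<forall>i\<in>{()}. blinfun_apply T x \<in> blinfun_apply \<phi> -` U}"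
    by (intro strong_operator_topology_basis) auto
  then show "openin strong_operator_topology (id -` W \<inter> topspace strong_operator_topology)"
    by (simp add: W strong_operator_topology_topspace)
qed (use open_UNIV in blast)

text \<open>The strong topology always refines the weak one, so lightness is the converse inclusion.
  This is continuity of the identity into the strong topology, which can be tested on one vector at
  a time.\<close>

lemma light_operators_iff_continuous_map:
  fixes G :: "('a::real_normed_vector \<Rightarrow>\<^sub>L 'a) set"
  shows "light_operators G \<longleftrightarrow>
    (\<forall>x. continuous_map (subtopology weak_operator_topology G) euclidean (\<lambda>T. blinfun_apply T x))"
proof -
  have "openin (subtopology strong_operator_topology G) V"
    if V: "openin (subtopology weak_operator_topology G) V" for V
  proof -
    obtain W where W: "openin weak_operator_topology W" "V = W \<inter> G"
      using V by (auto simp: openin_subtopology)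
    have "openin strong_operator_topology W"
      using openin_continuous_map_preimage[OF continuous_map_strong_weak_operator_topology W(1)]
      by (simp add: strong_operator_topology_topspace)
    then show ?thesis using W(2) by (auto simp: openin_subtopology)
  qed
  then have "light_operators G \<longleftrightarrow>
      (\<forall>V. openin (subtopology strong_operator_topology G) V \<longrightarrow>
        openin (subtopology weak_operator_topology G) V)"
    unfolding light_operators_def topology_eq by blast
  also have "\<dots> \<longleftrightarrow> continuous_map (subtopology weak_operator_topology G) strong_operator_topology (\<lambda>T. T)"
    unfolding continuous_map_def openin_subtopology
    by (auto simp: strong_operator_topology_topspace Int_def conj_commute)
  finally show ?thesis
    unfolding continuous_on_strong_operator_topo_iff_coordinatewise .
qed

text \<open>Point evaluations are bounded functionals, so the finitely many conditions of
  \<open>Isom_close_from_finite\<close> define a weakly open neighbourhood of \<open>T\<close> in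
  the isometry group.\<close>

lemma light_space_C01: "light_space TYPE(C01)"
  unfolding light_space_def light_operators_iff_continuous_map
proof
  fix f :: C01
  let ?X = "subtopology weak_operator_topology (Isom :: (C01 \<Rightarrow>\<^sub>L C01) set)"
  have eval: "blinfun_apply (Blinfun (\<lambda>g. apply_bcontfun g p)) = (\<lambda>g :: C01. apply_bcontfun g p)" for p
    by (intro bounded_linear_Blinfun_apply bounded_linear_intro[where K=1])
      (simp_all add: abs_bcontfun_le_norm)
  have "\<exists>W. openin ?X W \<and> T \<in> W \<and> W \<subseteq> {S \<in> Isom. blinfun_apply S f \<in> U}"
    if "open U" "T \<in> Isom" "blinfun_apply T f \<in> U" for U and T :: "C01 \<Rightarrow>\<^sub>L C01"
  proof -
    obtain e where e: "e > 0" "\<And>g. dist g (blinfun_apply T f) < e \<Longrightarrow> g \<in> U"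
      using \<open>open U\<close> \<open>blinfun_apply T f \<in> U\<close> unfolding open_dist by blast
    obtain F \<delta> where F: "finite F" "\<delta> > 0"
      "\<And>S. S \<in> Isom \<Longrightarrow>
      (\<And>g p. g \<in> {const_bcontfun 1, coordinate} \<Longrightarrow> p \<in> F \<Longrightarrow>
        dist (apply_bcontfun (blinfun_apply S g) p) (apply_bcontfun (blinfun_apply T g) p) < \<delta>) \<Longrightarrow>
      dist (blinfun_apply S f) (blinfun_apply T f) < e"
      using Isom_close_from_finite[OF \<open>T \<in> Isom\<close> e(1), where f = f] by blast
    define B where "B = (\<lambda>(g, p). {S :: C01 \<Rightarrow>\<^sub>L C01.
      apply_bcontfun (blinfun_apply S g) p \<in> ball (apply_bcontfun (blinfun_apply T g) p) \<delta>})"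
    define W where "W = Isom \<inter> \<Inter> (B ` ({const_bcontfun 1, coordinate} \<times> F))"
    have "openin weak_operator_topology (B x)" for x
      using openin_weak_operator_topology[of "ball _ \<delta>" "Blinfun (\<lambda>g. apply_bcontfun g (snd x))" "fst x"]
      unfolding eval B_def case_prod_beta by blast
    then have B: "openin ?X (Isom \<inter> B x)" for x
      by (simp add: openin_subtopology_Int2)
    \<comment> \<open>The leading factor \<open>Isom\<close> keeps the set inside the subspace even
      when \<open>F\<close> is empty and the intersection over it is everything.\<close>
    have "openin ?X (Isom \<inter> \<Inter> ((\<lambda>x. Isom \<inter> B x) ` ({const_bcontfun 1, coordinate} \<times> F)))"
    proof (rule openin_Int_Inter)
      show "finite ((\<lambda>x. Isom \<inter> B x) ` ({const_bcontfun 1, coordinate} \<times> F))"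
        using F(1) by simp
      show "openin ?X Isom" by (simp add: openin_subtopology_refl)
    qed (use B in blast)
    moreover have "W = Isom \<inter> \<Inter> ((\<lambda>x. Isom \<inter> B x) ` ({const_bcontfun 1, coordinate} \<times> F))"
      unfolding W_def by blast
    ultimately have "openin ?X W" by simp
    moreover have "T \<in> W" using \<open>T \<in> Isom\<close> F(2) by (auto simp: W_def B_def)
    moreover have "W \<subseteq> {S \<in> Isom. blinfun_apply S f \<in> U}"
    proof
      fix S assume "S \<in> W"
      then have S: "S \<in> Isom" "\<And>g p. g \<in> {const_bcontfun 1, coordinate} \<Longrightarrow> p \<in> F \<Longrightarrow> S \<in> B (g, p)"
        unfolding W_def by blast+
      have "dist (blinfun_apply S f) (blinfun_apply T f) < e"
      proof (rule F(3)[OF S(1)])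
        fix g p assume "g \<in> {const_bcontfun 1, coordinate}" "p \<in> F"
        then show "dist (apply_bcontfun (blinfun_apply S g) p) (apply_bcontfun (blinfun_apply T g) p) < \<delta>"
          using S(2)[of g p] unfolding B_def by (simp add: dist_commute)
      qed
      then show "S \<in> {S \<in> Isom. blinfun_apply S f \<in> U}" using S(1) e(2) by simp
    qed
    ultimately show ?thesis by blast
  qed
  then have "openin ?X {S \<in> Isom. blinfun_apply S f \<in> U}" if "open U" for U
    using that by (subst openin_subopen) blast
  then show "continuous_map ?X euclidean (\<lambda>T. blinfun_apply T f)"
    by (simp add: continuous_map_def)
qed

section \<open>Invariant norms\<close>

text \<open>Such a \<open>g\<close> is an increasing homeomorphism of the interval, onto by the
  intermediate value theorem. Composition with it is an isometry that carries
  \<open>coordinate\<close> to \<open>f\<close>.\<close>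

lemma invariant_norm_increasing:
  fixes N :: "C01 \<Rightarrow> real" and f :: C01
  assumes inv: "isometry_invariant N"
    and f: "\<And>t. apply_bcontfun f t = g (real_of_unit t)"
    and g: "continuous_on {0..1} g" "strict_mono_on {0..1} g" "g 0 = 0" "g 1 = 1"
  shows "N f = N coordinate"
proof -
  define \<phi> where "\<phi> t = Unit_Interval (g (real_of_unit t))" for t
  have "g x \<in> {0..1}" if "x \<in> {0..1}" for x
    using strict_mono_on_leD[OF g(2), of 0 x] strict_mono_on_leD[OF g(2), of x 1] that g(3,4) by simp
  then have \<phi>: "real_of_unit (\<phi> t) = g (real_of_unit t)" for t
    unfolding \<phi>_def using real_of_unit by (blast intro: Unit_Interval_inverse)
  have "continuous_on UNIV (\<lambda>t. real_of_unit (\<phi> t))"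
    unfolding f[symmetric] \<phi> by simp
  then have "continuous_on UNIV \<phi>"
    by (simp add: continuous_on_iff dist_unit_interval_def)
  moreover have "bij \<phi>"
  proof (rule bijI)
    show "inj \<phi>"
      using strict_mono_on_imp_inj_on[OF g(2)] real_of_unit
      by (metis \<phi> inj_onD injI real_of_unit_inject)
    have "\<exists>t. s = \<phi> t" for s
    proof -
      obtain x where x: "0 \<le> x" "x \<le> 1" "g x = real_of_unit s"
        using IVT'[of g 0 "real_of_unit s" 1] g by auto
      then have "real_of_unit (\<phi> (Unit_Interval x)) = real_of_unit s"
        by (simp add: \<phi> Unit_Interval_inverse)
      then show ?thesis by (metis real_of_unit_inject)
    qed
    then show "surj \<phi>" by (simp add: surj_def)
  qed
  ultimately obtain T :: "C01 \<Rightarrow>\<^sub>L C01" where T: "T \<in> Isom"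
    "\<And>f t. apply_bcontfun (blinfun_apply T f) t = apply_bcontfun f (\<phi> t)"
    using composition_Isom by blast
  have "N (blinfun_apply T coordinate) = N coordinate"
    using inv T(1) unfolding isometry_invariant_def by blast
  moreover have "blinfun_apply T coordinate = f"
    by (rule bcontfun_eqI) (simp add: T(2) \<phi> f)
  ultimately show ?thesis by simp
qed

text \<open>The functions \<open>t\<close>, \<open>t^2\<close> and their midpoint are all increasing
  homeomorphisms, so an invariant norm agrees on them. The unit sphere, up to scaling, then contains
  the midpoint of two distinct points.\<close>

lemma not_LUR_if_isometry_invariant:
  fixes N :: "C01 \<Rightarrow> real"
  assumes "is_norm N" "isometry_invariant N"
  shows "\<not> LUR N"
proof
  assume "LUR N"
  define q :: C01 where "q = Bcontfun (\<lambda>t. (real_of_unit t)\<^sup>2)"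
  have "continuous_on UNIV (\<lambda>t. (real_of_unit t)\<^sup>2)" by (intro continuous_intros)
  then have q: "apply_bcontfun q t = (real_of_unit t)\<^sup>2" for t
    unfolding q_def by (simp add: apply_Bcontfun_unit_interval)
  have sq: "strict_mono_on {0..1} (\<lambda>x::real. x\<^sup>2)"
    by (rule strict_mono_onI) (simp add: power_strict_mono)
  have Nq: "N q = N coordinate"
    by (rule invariant_norm_increasing[OF assms(2), where g = "\<lambda>x. x\<^sup>2"])
      (auto simp: q sq intro!: continuous_intros)
  have "N ((1/2) *\<^sub>R (coordinate + q)) = N coordinate"
  proof (rule invariant_norm_increasing[OF assms(2), where g = "\<lambda>x. (x + x\<^sup>2) / 2"])
    show "strict_mono_on {0..1} (\<lambda>x::real. (x + x\<^sup>2) / 2)"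
      using sq by (auto simp: strict_mono_on_def intro!: add_strict_mono)
  qed (auto simp: q intro!: continuous_intros)
  moreover have "N ((1/2) *\<^sub>R (coordinate + q)) = N (coordinate + q) / 2"
    using assms(1) unfolding is_norm_def by simp
  ultimately have sum: "N (coordinate + q) = 2 * N coordinate" by simp
  have half: "real_of_unit (Unit_Interval (1/2)) = 1/2" by (rule Unit_Interval_inverse) simp
  have "coordinate \<noteq> 0" using half apply_coordinate zero_bcontfun.rep_eq
    by (metis zero_neq_numeral divide_eq_0_iff one_neq_zero)
  then have "LUR_at N coordinate" using \<open>LUR N\<close> by (simp add: LUR_def)
  \<comment> \<open>The constant sequence with value \<open>q\<close> satisfies both limit
    conditions of LUR at \<open>coordinate\<close>, so it would have to converge to
    \<open>coordinate\<close>.\<close>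
  then have "(\<lambda>n::nat. N (q - coordinate)) \<longlonglongrightarrow> 0"
    unfolding LUR_at_def by (elim allE[of _ "\<lambda>n. q"]) (simp add: Nq sum)
  then have "N (q - coordinate) = 0" by (simp add: LIMSEQ_const_iff)
  then have "q - coordinate = 0" using assms(1) unfolding is_norm_def by blast
  \<comment> \<open>At \<open>1/2\<close> the two functions take the values \<open>1/4\<close> and
    \<open>1/2\<close>.\<close>
  then have "apply_bcontfun (q - coordinate) (Unit_Interval (1/2)) = 0" by simp
  then show False by (simp add: q half power2_eq_square)
qed

theorem corollary5p12:
  shows "light_space TYPE(C01) \<and>
    \<not> (\<exists>N :: C01 \<Rightarrow> real. renorming N \<and> isometry_invariant N \<and> LUR N)"
  using light_space_C01 not_LUR_if_isometry_invariant by (auto simp: renorming_def)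

end
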